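(* Let $G$ be a finite group with identity $e$, let $L$ be its Cayley table, $L(x,y)=xy$, and let $K$ be the Latin square $K(x,y)=x\mu(y)$, where $\mu\colon G\to G$ is a bijection with $\mu(e)=e$, such that $L$ and $K$ are orthogonal. Let $(\alpha,\beta,\gamma,\delta)$ be an autotopy of $(L,K)$, i.e. bijections $G\to G$ with $\gamma(xy)=\alpha(x)\beta(y)$ and $\delta(x\mu(y))=\alpha(x)\mu(\beta(y))$ for all $x,y\in G$. Then there exist $a,b\in G$ and $\varphi\in\mathrm{Aut}(G)$ with $\varphi(\mu(y))\mu(b^{-1})=\mu(\varphi(y)b^{-1})$ for all $y\in G$, such that for all $z\in G$: $\alpha(z)=a\varphi(z)$, $\beta(z)=\varphi(z)b^{-1}$, $\gamma(z)=a\varphi(z)b^{-1}$, and $\delta(z)=a\varphi(z)\mu(b^{-1})$.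
   Context: Latin squares $L,K$ on $G$ (rows, columns indexed by $G$) are orthogonal if every ordered pair of symbols occurs exactly once among the pairs $(L(x,y),K(x,y))$. An autotopy of the pair $(L,K)$ is a quadruple of bijections of $G$ (acting on rows, columns, symbols of $L$, symbols of $K$) preserving the orthogonal array $\{(x,y,xy,x\mu(y))\}$, which amounts to the two displayed identities. *)

theory Defs
  imports "HOL-Algebra.Bij"
begin

definition latin_square :: "'a set \<Rightarrow> ('a \<Rightarrow> 'a \<Rightarrow> 'a) \<Rightarrow> bool" where
  "latin_square S L \<longleftrightarrow>
     (\<forall>x\<in>S. bij_betw (\<lambda>y. L x y) S S) \<and> (\<forall>y\<in>S. bij_betw (\<lambda>x. L x y) S S)"

definition orthogonal_latin_squares ::
    "'a set \<Rightarrow> ('a \<Rightarrow> 'a \<Rightarrow> 'a) \<Rightarrow> ('a \<Rightarrow> 'a \<Rightarrow> 'a) \<Rightarrow> bool" where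
  "orthogonal_latin_squares S L K \<longleftrightarrow>
     latin_square S L \<and> latin_square S K \<and>
     (\<forall>s\<in>S. \<forall>t\<in>S. \<exists>!(x, y). x \<in> S \<and> y \<in> S \<and> L x y = s \<and> K x y = t)"

definition orthogonal_array ::
    "'a set \<Rightarrow> ('a \<Rightarrow> 'a \<Rightarrow> 'a) \<Rightarrow> ('a \<Rightarrow> 'a \<Rightarrow> 'a) \<Rightarrow> ('a \<times> 'a \<times> 'a \<times> 'a) set" where
  "orthogonal_array S L K = {(x, y, L x y, K x y) | x y. x \<in> S \<and> y \<in> S}"

definition autotopy ::
    "'a set \<Rightarrow> ('a \<Rightarrow> 'a \<Rightarrow> 'a) \<Rightarrow> ('a \<Rightarrow> 'a \<Rightarrow> 'a) \<Rightarrow>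
     ('a \<Rightarrow> 'a) \<Rightarrow> ('a \<Rightarrow> 'a) \<Rightarrow> ('a \<Rightarrow> 'a) \<Rightarrow> ('a \<Rightarrow> 'a) \<Rightarrow> bool" where
  "autotopy S L K \<alpha> \<beta> \<gamma> \<delta> \<longleftrightarrow>
     bij_betw \<alpha> S S \<and> bij_betw \<beta> S S \<and> bij_betw \<gamma> S S \<and> bij_betw \<delta> S S \<and>
     (\<lambda>(x, y, u, v). (\<alpha> x, \<beta> y, \<gamma> u, \<delta> v)) ` orthogonal_array S L K = orthogonal_array S L K"

lemma autotopy_iff:
  "autotopy S L K \<alpha> \<beta> \<gamma> \<delta> \<longleftrightarrow>
     bij_betw \<alpha> S S \<and> bij_betw \<beta> S S \<and> bij_betw \<gamma> S S \<and> bij_betw \<delta> S S \<and>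
     (\<forall>x\<in>S. \<forall>y\<in>S. \<gamma> (L x y) = L (\<alpha> x) (\<beta> y) \<and> \<delta> (K x y) = K (\<alpha> x) (\<beta> y))"
  (is "_ \<longleftrightarrow> ?B \<and> ?C \<and> ?D \<and> ?E \<and> ?I")
proof -
  let ?f = "\<lambda>(x, y, u, v). (\<alpha> x, \<beta> y, \<gamma> u, \<delta> v)"
  let ?A = "orthogonal_array S L K"
  have "?f ` ?A = ?A \<longleftrightarrow> ?I" if b: ?B and c: ?C
  proof
    assume eq: "?f ` ?A = ?A"
    show ?I
    proof (intro ballI)
      fix x y assume "x \<in> S" "y \<in> S"
      then have "(x, y, L x y, K x y) \<in> ?A" by (auto simp: orthogonal_array_def)
      then have "?f (x, y, L x y, K x y) \<in> ?A" using eq by blast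
      then show "\<gamma> (L x y) = L (\<alpha> x) (\<beta> y) \<and> \<delta> (K x y) = K (\<alpha> x) (\<beta> y)"
        by (auto simp: orthogonal_array_def)
    qed
  next
    assume I: ?I
    show "?f ` ?A = ?A"
    proof
      show "?f ` ?A \<subseteq> ?A"
        using I bij_betwE[OF b] bij_betwE[OF c] by (auto simp: orthogonal_array_def)
      show "?A \<subseteq> ?f ` ?A"
      proof
        fix p assume "p \<in> ?A"
        then obtain x' y' where p: "p = (x', y', L x' y', K x' y')" "x' \<in> S" "y' \<in> S"
          by (auto simp: orthogonal_array_def)
        obtain x where x: "x \<in> S" "x' = \<alpha> x"
          using p(2) b unfolding bij_betw_def by blast
        obtain y where y: "y \<in> S" "y' = \<beta> y"
          using p(3) c unfolding bij_betw_def by blast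
        have "p = ?f (x, y, L x y, K x y)" using p x y I by simp
        moreover have "(x, y, L x y, K x y) \<in> ?A"
          using x y by (auto simp: orthogonal_array_def)
        ultimately show "p \<in> ?f ` ?A" by (rule image_eqI)
      qed
    qed
  qed
  then show ?thesis unfolding autotopy_def by blast
qed

end

theory Submission
  imports Defs
begin

text \<open>
  Put \<open>a = \<alpha> e\<close> and \<open>b\<inverse> = \<beta> e\<close>. Comparing the first identity at \<open>(z, e)\<close> and \<open>(e, z)\<close>
  expresses \<open>\<beta>\<close> and \<open>\<gamma>\<close> through \<open>\<phi> z = a\<inverse> \<alpha> z\<close>; substituting back and cancelling shows that
  \<open>\<phi>\<close> is multiplicative. The second identity at \<open>(z, e)\<close> gives \<open>\<delta>\<close>, because \<open>\<mu> e = e\<close>, and at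
  \<open>(e, y)\<close> it gives the compatibility of \<open>\<phi>\<close> with \<open>\<mu>\<close>.
\<close>

theorem theorem5p4:
  fixes G :: "('a, 'b) monoid_scheme" (structure)
    and \<mu> \<alpha> \<beta> \<gamma> \<delta> :: "'a \<Rightarrow> 'a"
  assumes "group G" and "finite (carrier G)"
    and "bij_betw \<mu> (carrier G) (carrier G)" and "\<mu> \<one> = \<one>"
    and "orthogonal_latin_squares (carrier G) (\<lambda>x y. x \<otimes> y) (\<lambda>x y. x \<otimes> \<mu> y)"
    and "autotopy (carrier G) (\<lambda>x y. x \<otimes> y) (\<lambda>x y. x \<otimes> \<mu> y) \<alpha> \<beta> \<gamma> \<delta>"
  shows "\<exists>a\<in>carrier G. \<exists>b\<in>carrier G. \<exists>\<phi>\<in>auto G.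
     (\<forall>y\<in>carrier G. \<phi> (\<mu> y) \<otimes> \<mu> (inv b) = \<mu> (\<phi> y \<otimes> inv b)) \<and>
     (\<forall>z\<in>carrier G.
        \<alpha> z = a \<otimes> \<phi> z \<and>
        \<beta> z = \<phi> z \<otimes> inv b \<and>
        \<gamma> z = a \<otimes> \<phi> z \<otimes> inv b \<and>
        \<delta> z = a \<otimes> \<phi> z \<otimes> \<mu> (inv b))"
proof -
  interpret group G by fact
  let ?S = "carrier G"
  have bij: "bij_betw \<alpha> ?S ?S" "bij_betw \<beta> ?S ?S"
    and \<gamma>: "\<And>x y. x \<in> ?S \<Longrightarrow> y \<in> ?S \<Longrightarrow> \<gamma> (x \<otimes> y) = \<alpha> x \<otimes> \<beta> y"
    and \<delta>: "\<And>x y. x \<in> ?S \<Longrightarrow> y \<in> ?S \<Longrightarrow> \<delta> (x \<otimes> \<mu> y) = \<alpha> x \<otimes> \<mu> (\<beta> y)"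
    using assms(6) by (auto simp: autotopy_iff)
  have closed [simp, intro]: "\<alpha> x \<in> ?S" "\<beta> x \<in> ?S" "\<mu> x \<in> ?S" if "x \<in> ?S" for x
    using that bij assms(3) by (auto dest: bij_betwE)
  define a where "a = \<alpha> \<one>"
  \<comment> \<open>\<open>c\<close> plays the role of the inverse of b; the witness for b is
    \<open>inv c\<close>.\<close>
  define c where "c = \<beta> \<one>"
  \<comment> \<open>Members of \<open>auto G\<close> are extensional by way of \<open>Bij\<close>,
    hence the \<open>restrict\<close>.\<close>
  define \<phi> where "\<phi> = restrict (\<lambda>z. inv a \<otimes> \<alpha> z) ?S"
  have a [simp]: "a \<in> ?S" and c [simp]: "c \<in> ?S"
    by (auto simp: a_def c_def)
  have \<phi>_closed [simp]: "\<phi> z \<in> ?S" if "z \<in> ?S" for z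
    using that by (simp add: \<phi>_def)
  have \<alpha>_eq: "\<alpha> z = a \<otimes> \<phi> z" if "z \<in> ?S" for z
    using that by (simp add: \<phi>_def m_assoc [symmetric])
  have \<gamma>_eq: "\<gamma> z = a \<otimes> \<phi> z \<otimes> c" if "z \<in> ?S" for z
    using \<gamma> [of z \<one>] that by (simp add: \<alpha>_eq c_def)
  have \<beta>_eq: "\<beta> z = \<phi> z \<otimes> c" if "z \<in> ?S" for z
  proof -
    have "a \<otimes> \<beta> z = a \<otimes> (\<phi> z \<otimes> c)"
      using \<gamma> [of \<one> z] that by (simp add: \<gamma>_eq m_assoc flip: a_def)
    then show ?thesis using that by simp
  qed
  have \<delta>_eq: "\<delta> z = a \<otimes> \<phi> z \<otimes> \<mu> c" if "z \<in> ?S" for z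
    using \<delta> [of z \<one>] that by (simp add: \<alpha>_eq assms(4) flip: c_def)
  have "\<phi> \<in> hom G G"
  proof (rule homI)
    fix x y assume xy: "x \<in> ?S" "y \<in> ?S"
    \<comment> \<open>Both sides are \<gamma> at the product; cancelling a on the left and c on the
      right remains.\<close>
    then have "a \<otimes> (\<phi> (x \<otimes> y) \<otimes> c) = a \<otimes> (\<phi> x \<otimes> \<phi> y \<otimes> c)"
      using \<gamma> [of x y] by (simp add: \<gamma>_eq \<alpha>_eq \<beta>_eq m_assoc)
    then show "\<phi> (x \<otimes> y) = \<phi> x \<otimes> \<phi> y" using xy by simp
  qed simp
  moreover have "\<phi> \<in> Bij ?S"
  proof -
    \<comment> \<open>On the carrier, \<phi> is \<alpha> followed by this left translation, whose
      inverse is translation by a.\<close>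
    have "bij_betw (\<lambda>x. inv a \<otimes> x) ?S ?S"
      by (rule bij_betw_byWitness [where f' = "\<lambda>x. a \<otimes> x"]) (auto simp: m_assoc [symmetric])
    with bij(1) have "bij_betw ((\<lambda>x. inv a \<otimes> x) \<circ> \<alpha>) ?S ?S"
      by (rule bij_betw_trans)
    then have "bij_betw \<phi> ?S ?S"
      by (rule bij_betw_cong [THEN iffD1, rotated]) (simp add: \<phi>_def)
    then show ?thesis by (simp add: Bij_def \<phi>_def)
  qed
  ultimately have auto: "\<phi> \<in> auto G" by (simp add: auto_def)
  have \<mu>_eq: "\<phi> (\<mu> y) \<otimes> \<mu> c = \<mu> (\<phi> y \<otimes> c)" if "y \<in> ?S" for y
  proof -
    \<comment> \<open>Two values of \<delta> at \<open>\<mu> y\<close>: the formula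
      \<open>\<delta>_eq\<close>, and the autotopy identity in row \<open>\<one>\<close>.\<close>
    have "a \<otimes> (\<phi> (\<mu> y) \<otimes> \<mu> c) = a \<otimes> \<mu> (\<phi> y \<otimes> c)"
      using \<delta> [of \<one> y] that by (simp add: \<delta>_eq \<beta>_eq m_assoc flip: a_def)
    then show ?thesis using that by simp
  qed
  show ?thesis
    by (rule bexI [of _ a], rule bexI [of _ "inv c"], rule bexI [of _ \<phi>])
      (simp_all add: auto \<mu>_eq \<alpha>_eq \<beta>_eq \<gamma>_eq \<delta>_eq)
qed

end
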